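(* Let $m\le n$ be positive integers, let $\pi$ be a uniformly distributed random permutation of $[n]=\{1,\ldots,n\}$, and let $F$ be the fraction of the elements of $[n]$ that are contained in cycles of $\pi$ that are disjoint from $[m]=\{1,\ldots,m\}$, i.e., $F=\frac{1}{n}\bigl(n-\bigl|C^n_{[m]}(\pi)\bigr|\bigr)$. Then (regardless of the value of $n$) the expectation of $F$ is less than $\frac{1}{m+1}$, and the standard deviation of $F$ is less than $\frac{1}{m+1}$ as well.
   Context: For a positive integer $n$, $[n]=\{1,2,\ldots,n\}$ and $S_n$ is the set of all permutations of $[n]$. The probability space is $S_n$ with the uniform measure; $\pi\in S_n$ denotes the outcome. For $M\subseteq[n]$, define $C^n_M(\pi)=\bigcup_{i\in M}\{\pi^{t}(i)\mid t\in\{1,2,3,\ldots\}\}$, the set of all elements of all cycles of $\pi$ that contain at least one element of $M$ (fixed points are cycles of length 1). *)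

theory Defs
  imports "HOL-Probability.Probability" "HOL-Combinatorics.Combinatorics"
begin

text \<open>
  Elements of all cycles of \<open>p\<close> that meet \<open>M\<close>. For \<open>p permutes {1..n}\<close> and
  \<open>M \<subseteq> {1..n}\<close> this is a subset of \<open>{1..n}\<close>, so \<open>n\<close> need not be a parameter.
\<close>
definition cycle_elems :: "nat set \<Rightarrow> (nat \<Rightarrow> nat) \<Rightarrow> nat set" where
  "cycle_elems M p = (\<Union>i\<in>M. {(p ^^ t) i | t. t \<ge> 1})"

definition random_perm :: "nat \<Rightarrow> (nat \<Rightarrow> nat) pmf" where
  "random_perm n = pmf_of_set {p. p permutes {1..n}}"

definition avoiding_fraction :: "nat \<Rightarrow> nat \<Rightarrow> (nat \<Rightarrow> nat) \<Rightarrow> real" where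
  "avoiding_fraction n m p = 1 / real n * (real n - real (card (cycle_elems {1..m} p)))"

definition std_dev :: "'a pmf \<Rightarrow> ('a \<Rightarrow> real) \<Rightarrow> real" where
  "std_dev P X = sqrt (measure_pmf.variance P X)"

end

theory Submission
  imports Defs
begin

text \<open>
  Let \<open>X\<close> be the number of points whose cycle avoids \<open>M\<close>. Inserting a new point \<open>a\<close> in front of
  a uniformly chosen \<open>b\<close> (or as a fixed point, if \<open>b = a\<close>) turns a uniform permutation of \<open>S\<close>
  into one of \<open>insert a S\<close>, and \<open>X\<close> grows by one with probability \<open>(X + 1) / (card S + 1)\<close>: this
  is a Polya urn. Hence the rising factorials \<open>X + 1\<close> and \<open>(X + 1) * (X + 2)\<close> are martingales up
  to explicit factors, which gives the first two moments of \<open>X\<close> exactly.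
\<close>

section \<open>Cycles meeting a set, as closed unions of orbits\<close>

lemma cycle_elems_eq_orbits: "cycle_elems M p = (\<Union>i\<in>M. orbit p i)"
  by (auto simp: cycle_elems_def orbit_altdef Suc_le_eq)

lemma cycle_elems_closed: "x \<in> cycle_elems M p \<Longrightarrow> p x \<in> cycle_elems M p"
  by (auto simp: cycle_elems_eq_orbits intro: orbit.step)

text \<open>An orbit starts at \<open>p i\<close>, not at \<open>i\<close>; it returns to
  \<open>i\<close> because \<open>p\<close> permutes a finite set.\<close>

lemma subset_cycle_elems:
  assumes "p permutes S" "finite S"
  shows "M \<subseteq> cycle_elems M p"
proof -
  have "permutation p" using assms by (auto simp: permutation_permutes)
  then show ?thesis
    by (auto simp: cycle_elems_eq_orbits intro: permutation_self_in_orbit)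
qed

text \<open>Minimality among the closed supersets of \<open>M\<close>: an inclusion between two such
  sets reduces to a closure check, with no reasoning about powers of \<open>p\<close>.\<close>

lemma cycle_elems_least:
  assumes "M \<subseteq> D" "\<And>x. x \<in> D \<Longrightarrow> p x \<in> D"
  shows "cycle_elems M p \<subseteq> D"
proof -
  have "x \<in> D" if "x \<in> orbit p i" "i \<in> M" for x i
    using that by induction (use assms in auto)
  then show ?thesis by (auto simp: cycle_elems_eq_orbits)
qed

lemma cycle_elems_subset:
  assumes "p permutes S" "M \<subseteq> S"
  shows "cycle_elems M p \<subseteq> S"
  using assms by (intro cycle_elems_least) (auto simp: permutes_in_image)

text \<open>The predecessor of \<open>y\<close> is an earlier orbit point or, if \<open>y\<close> is
  the first one, the starting point \<open>i\<close> in \<open>M\<close>.\<close>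

lemma cycle_elems_preimage:
  assumes "p permutes S" "finite S" "y \<in> cycle_elems M p"
  obtains x where "x \<in> cycle_elems M p" "p x = y"
proof -
  from assms(3) obtain i where i: "i \<in> M" "y \<in> orbit p i"
    by (auto simp: cycle_elems_eq_orbits)
  from i(2) have "\<exists>x\<in>cycle_elems M p. p x = y"
  proof cases
    case base
    then show ?thesis using subset_cycle_elems[OF assms(1,2)] i(1) by blast
  next
    case (step z)
    then show ?thesis using i(1) by (auto simp: cycle_elems_eq_orbits)
  qed
  with that show thesis by blast
qed

text \<open>Composing with the transposition redirects the \<open>q\<close>-predecessor of
  \<open>b\<close> to \<open>a\<close> and sends \<open>a\<close> to \<open>b\<close>; all other
  arrows stay. So \<open>a\<close> joins the cycle of \<open>b\<close>, or becomes a fixed point if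
  \<open>b = a\<close>. Minimality is applied once to \<open>p\<close> and once to
  \<open>q\<close>.\<close>

lemma cycle_elems_insert_point:
  assumes q: "q permutes S" and S: "finite S" "a \<notin> S" "M \<subseteq> S" and b: "b \<in> insert a S"
  shows "cycle_elems M (Transposition.transpose a b \<circ> q) =
    cycle_elems M q \<union> (if b \<in> cycle_elems M q then {a} else {})"
proof -
  define p where "p = Transposition.transpose a b \<circ> q"
  define C where "C = cycle_elems M q"
  define D where "D = cycle_elems M p"
  have q': "q permutes insert a S" using q by (rule permutes_subset) auto
  have p: "p permutes insert a S"
    unfolding p_def using b by (intro permutes_compose[OF q'] permutes_swap_id) auto
  have qa: "q a = a" using q S(2) by (rule permutes_not_in)
  have q_ne: "q x \<noteq> a" if "x \<noteq> a" for x
    using that qa permutes_inj[OF q] by (metis injD)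
  have pa: "p a = b" by (simp add: p_def qa)
  have p_b: "p x = a" if "q x = b" for x using that by (simp add: p_def)
  have p_other: "p x = q x" if "x \<noteq> a" "q x \<noteq> b" for x
    using that q_ne by (simp add: p_def transpose_apply_other)
  have CS: "C \<subseteq> S" unfolding C_def using q S(3) by (rule cycle_elems_subset)
  have MC: "M \<subseteq> C" unfolding C_def using q S(1) by (rule subset_cycle_elems)
  have MD: "M \<subseteq> D" unfolding D_def by (rule subset_cycle_elems[OF p]) (simp add: S(1))
  have Cc: "q x \<in> C" if "x \<in> C" for x using that unfolding C_def by (rule cycle_elems_closed)
  have Dc: "p x \<in> D" if "x \<in> D" for x using that unfolding D_def by (rule cycle_elems_closed)
  have "D \<subseteq> C \<union> (if b \<in> C then {a} else {})"
    unfolding D_def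
  proof (rule cycle_elems_least)
    fix x assume x: "x \<in> C \<union> (if b \<in> C then {a} else {})"
    show "p x \<in> C \<union> (if b \<in> C then {a} else {})"
    proof (cases "x = a")
      case True
      then show ?thesis using x CS S(2) pa by (auto split: if_splits)
    next
      case False
      then have "q x \<in> C" using x Cc by (auto split: if_splits)
      then show ?thesis using p_b[of x] p_other[OF False] by (cases "q x = b") auto
    qed
  qed (use MC in auto)
  \<comment> \<open>Closure under \<open>q\<close> means bypassing \<open>a\<close>: if
    \<open>q x = b\<close>, then \<open>p x = a\<close> lies in \<open>D\<close>, hence so does
    \<open>p a = b\<close>.\<close>
  moreover have CD: "C \<subseteq> D - {a}"
    unfolding C_def
  proof (rule cycle_elems_least)
    fix x assume x: "x \<in> D - {a}"
    show "q x \<in> D - {a}"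
    proof (cases "q x = b")
      case True
      then show ?thesis using x Dc[of x] Dc[of a] p_b[of x] pa q_ne[of x] by auto
    next
      case False
      then show ?thesis using x Dc[of x] p_other[of x] q_ne[of x] by auto
    qed
  qed (use MD S in auto)
  moreover have "a \<in> D" if "b \<in> C"
  proof -
    obtain x where "x \<in> C" "q x = b"
      using cycle_elems_preimage[OF q S(1)] \<open>b \<in> C\<close> unfolding C_def by metis
    then show ?thesis using CD Dc[of x] p_b[of x] by auto
  qed
  ultimately show ?thesis unfolding C_def D_def p_def by auto
qed

section \<open>The number of avoiding points and its urn transition\<close>

definition num_avoiding :: "nat set \<Rightarrow> nat set \<Rightarrow> (nat \<Rightarrow> nat) \<Rightarrow> nat" where
  "num_avoiding S M p = card (S - cycle_elems M p)"

lemma num_avoiding_eq: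
  assumes "p permutes S" "finite S" "M \<subseteq> S"
  shows "real (num_avoiding S M p) = real (card S) - real (card (cycle_elems M p))"
proof -
  have "cycle_elems M p \<subseteq> S" using assms by (intro cycle_elems_subset)
  with \<open>finite S\<close> show ?thesis
    unfolding num_avoiding_def
    by (simp add: card_Diff_subset finite_subset card_mono of_nat_diff)
qed

lemma num_avoiding_insert_point:
  assumes q: "q permutes S" and S: "finite S" "a \<notin> S" "M \<subseteq> S" and b: "b \<in> insert a S"
  shows "num_avoiding (insert a S) M (Transposition.transpose a b \<circ> q) =
    (if b \<in> cycle_elems M q then num_avoiding S M q else num_avoiding S M q + 1)"
proof -
  let ?C = "cycle_elems M q"
  have "?C \<subseteq> S" using q S(3) by (rule cycle_elems_subset)
  with S(2) have "a \<notin> ?C" by auto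
  then have "insert a S - (?C \<union> (if b \<in> ?C then {a} else {})) =
      (if b \<in> ?C then S - ?C else insert a (S - ?C))"
    using S(2) by auto
  then show ?thesis
    unfolding num_avoiding_def cycle_elems_insert_point[OF assms] using S by auto
qed

text \<open>Every permutation of \<open>insert a S\<close> arises from exactly one pair
  \<open>(b, q)\<close>. For fixed \<open>q\<close>, the count rises for the \<open>b\<close>
  outside the cycles meeting \<open>M\<close> and stays the same for the others. Leaving
  \<open>g\<close> arbitrary lets both moments use the same recursion.\<close>

lemma sum_num_avoiding_insert:
  fixes g :: "nat \<Rightarrow> real"
  assumes S: "finite S" "a \<notin> S" "M \<subseteq> S"
  shows "(\<Sum>p | p permutes insert a S. g (num_avoiding (insert a S) M p)) =
    (\<Sum>q | q permutes S. real (num_avoiding S M q + 1) * g (num_avoiding S M q + 1) +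
      (real (card S) - real (num_avoiding S M q)) * g (num_avoiding S M q))"
proof -
  have "(\<Sum>b\<in>insert a S. g (num_avoiding (insert a S) M (Transposition.transpose a b \<circ> q))) =
      real (num_avoiding S M q + 1) * g (num_avoiding S M q + 1) +
      (real (card S) - real (num_avoiding S M q)) * g (num_avoiding S M q)"
    if q: "q permutes S" for q
  proof -
    let ?C = "cycle_elems M q" and ?X = "num_avoiding S M q"
    have CS: "?C \<subseteq> S" using q S(3) by (rule cycle_elems_subset)
    have "(\<Sum>b\<in>insert a S. g (num_avoiding (insert a S) M (Transposition.transpose a b \<circ> q))) =
        (\<Sum>b\<in>insert a S. if b \<in> ?C then g ?X else g (?X + 1))"
      by (intro sum.cong) (auto simp: num_avoiding_insert_point[OF q S])
    also have "\<dots> = real (card (insert a S \<inter> ?C)) * g ?X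
        + real (card (insert a S - ?C)) * g (?X + 1)"
      using S(1) by (subst sum.If_cases) (auto simp: Diff_eq)
    also have "insert a S \<inter> ?C = ?C" using CS by auto
    \<comment> \<open>The choice \<open>b = a\<close> also raises the count, hence
      \<open>?X + 1\<close> favourable choices.\<close>
    also have "insert a S - ?C = insert a (S - ?C)" using CS S(2) by auto
    also have "card (insert a (S - ?C)) = ?X + 1"
      using S by (simp add: num_avoiding_def)
    also have "real (card ?C) = real (card S) - real ?X"
      using num_avoiding_eq[OF q S(1,3)] by simp
    finally show ?thesis by (simp only: add.commute)
  qed
  then show ?thesis
    unfolding sum_over_permutations_insert[OF S(1,2)]
    by (subst sum.swap) (auto intro: sum.cong)
qed

section \<open>Sums of the first two rising factorials\<close>

lemma num_avoiding_self:
  assumes "p permutes M" "finite M"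
  shows "num_avoiding M M p = 0"
  using subset_cycle_elems[OF assms, of M] by (simp add: num_avoiding_def Diff_eq_empty_iff[THEN iffD2])

text \<open>With s = \<open>card S\<close>, the recursion gives (x+1)(x+2) + (s-x)(x+1) =
  (s+2)(x+1), so each new point multiplies the sum by s+2. The start is \<open>S = M\<close>, where
  the count is 0.\<close>

lemma sum_num_avoiding_first:
  assumes "finite S" "M \<subseteq> S"
  shows "(\<Sum>p | p permutes S. real (num_avoiding S M p) + 1) =
    fact (card S) * (real (card S) + 1) / (real (card M) + 1)"
proof -
  have M: "finite M" using assms by (rule rev_finite_subset)
  \<comment> \<open>The points outside \<open>M\<close> are added one at a time while
    \<open>M\<close> stays fixed.\<close>
  have "(\<Sum>p | p permutes M \<union> T. real (num_avoiding (M \<union> T) M p) + 1) =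
      fact (card (M \<union> T)) * (real (card (M \<union> T)) + 1) / (real (card M) + 1)"
    if "T \<subseteq> S - M" "finite T" for T
    using that(2,1)
  proof (induction T)
    case empty
    then show ?case using M by (simp add: num_avoiding_self card_permutations)
  next
    case (insert a T)
    let ?S = "M \<union> T"
    have S: "finite ?S" "a \<notin> ?S" "M \<subseteq> ?S" using insert M by auto
    have "(\<Sum>p | p permutes insert a ?S. real (num_avoiding (insert a ?S) M p) + 1) =
      (\<Sum>q | q permutes ?S. (real (card ?S) + 2) * (real (num_avoiding ?S M q) + 1))"
      unfolding sum_num_avoiding_insert[OF S, of "\<lambda>x. real x + 1"]
      by (intro sum.cong) (auto simp: algebra_simps)
    also have "\<dots> = (real (card ?S) + 2) *
        (fact (card ?S) * (real (card ?S) + 1) / (real (card M) + 1))"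
      using insert by (simp add: sum_distrib_left[symmetric])
    finally show ?case using S by (simp add: field_simps)
  qed
  from this[of "S - M"] show ?thesis using assms by (simp add: Un_absorb1)
qed

text \<open>Here (x+1)(x+2)(x+3) + (s-x)(x+1)(x+2) = (s+3)(x+1)(x+2), so the factor is s+3. The
  leading 2 is the value of (x+1)(x+2) at x = 0.\<close>

lemma sum_num_avoiding_second:
  assumes "finite S" "M \<subseteq> S"
  shows "(\<Sum>p | p permutes S. (real (num_avoiding S M p) + 1) * (real (num_avoiding S M p) + 2)) =
    2 * fact (card S) * ((real (card S) + 1) * (real (card S) + 2)) /
      ((real (card M) + 1) * (real (card M) + 2))"
proof -
  have M: "finite M" using assms by (rule rev_finite_subset)
  have "(\<Sum>p | p permutes M \<union> T.
        (real (num_avoiding (M \<union> T) M p) + 1) * (real (num_avoiding (M \<union> T) M p) + 2)) =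
      2 * fact (card (M \<union> T)) * ((real (card (M \<union> T)) + 1) * (real (card (M \<union> T)) + 2)) /
        ((real (card M) + 1) * (real (card M) + 2))"
    if "T \<subseteq> S - M" "finite T" for T
    using that(2,1)
  proof (induction T)
    case empty
    then show ?case using M by (simp add: num_avoiding_self card_permutations)
  next
    case (insert a T)
    let ?S = "M \<union> T"
    have S: "finite ?S" "a \<notin> ?S" "M \<subseteq> ?S" using insert M by auto
    have "(\<Sum>p | p permutes insert a ?S.
        (real (num_avoiding (insert a ?S) M p) + 1) * (real (num_avoiding (insert a ?S) M p) + 2)) =
      (\<Sum>q | q permutes ?S. (real (card ?S) + 3) *
        ((real (num_avoiding ?S M q) + 1) * (real (num_avoiding ?S M q) + 2)))"
      unfolding sum_num_avoiding_insert[OF S, of "\<lambda>x. (real x + 1) * (real x + 2)"]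
      by (intro sum.cong) (auto simp: algebra_simps)
    also have "\<dots> = (real (card ?S) + 3) *
        (2 * fact (card ?S) * ((real (card ?S) + 1) * (real (card ?S) + 2)) /
          ((real (card M) + 1) * (real (card M) + 2)))"
      using insert by (simp add: sum_distrib_left[symmetric])
    finally show ?case using S by (simp add: field_simps)
  qed
  from this[of "S - M"] show ?thesis using assms by (simp add: Un_absorb1)
qed

section \<open>Moments under the uniform measure\<close>

lemma set_pmf_random_perm [simp]: "set_pmf (random_perm n) = {p. p permutes {1..n}}"
  unfolding random_perm_def
  by (intro set_pmf_of_set) (auto simp: finite_permutations intro: exI[of _ id] permutes_id)

lemma expectation_random_perm:
  fixes f :: "(nat \<Rightarrow> nat) \<Rightarrow> real"
  shows "measure_pmf.expectation (random_perm n) f = (\<Sum>p | p permutes {1..n}. f p) / fact n"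
proof -
  have nonempty: "{p. p permutes {1..n}} \<noteq> {}" using permutes_id by blast
  have finite: "finite {p. p permutes {1..n}}" by (simp add: finite_permutations)
  have "card {p. p permutes {1..n}} = fact n" by (simp add: card_permutations)
  then show ?thesis
    unfolding random_perm_def integral_pmf_of_set[OF nonempty finite] by simp
qed

lemma integrable_random_perm [simp]:
  fixes f :: "(nat \<Rightarrow> nat) \<Rightarrow> real"
  shows "integrable (measure_pmf (random_perm n)) f"
  by (rule integrable_measure_pmf_finite) (simp add: finite_permutations)

lemma expectation_num_avoiding:
  assumes "m \<le> n"
  shows "measure_pmf.expectation (random_perm n) (\<lambda>p. real (num_avoiding {1..n} {1..m} p)) =
    (real n - real m) / (real m + 1)"
proof -
  let ?E = "measure_pmf.expectation (random_perm n)" and ?X = "\<lambda>p. real (num_avoiding {1..n} {1..m} p)"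
  have "?E (\<lambda>p. ?X p + 1) = (real n + 1) / (real m + 1)"
    unfolding expectation_random_perm using sum_num_avoiding_first[of "{1..n}" "{1..m}"] assms by simp
  then have "?E ?X = (real n + 1) / (real m + 1) - 1" by simp
  also have "\<dots> = (real n - real m) / (real m + 1)" by (simp add: field_simps)
  finally show ?thesis .
qed

lemma expectation_num_avoiding_square:
  assumes "m \<le> n"
  shows "measure_pmf.expectation (random_perm n) (\<lambda>p. (real (num_avoiding {1..n} {1..m} p))\<^sup>2) =
    (real n - real m) * (2 * real n - real m) / ((real m + 1) * (real m + 2))"
proof -
  let ?E = "measure_pmf.expectation (random_perm n)" and ?X = "\<lambda>p. real (num_avoiding {1..n} {1..m} p)"
  have "?E (\<lambda>p. (?X p)\<^sup>2) = ?E (\<lambda>p. (?X p + 1) * (?X p + 2) - 3 * ?X p - 2)"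
    by (simp add: power2_eq_square algebra_simps)
  also have "\<dots> = ?E (\<lambda>p. (?X p + 1) * (?X p + 2)) - 3 * ?E ?X - 2"
    by simp
  also have "?E (\<lambda>p. (?X p + 1) * (?X p + 2)) =
      2 * ((real n + 1) * (real n + 2)) / ((real m + 1) * (real m + 2))"
    unfolding expectation_random_perm using sum_num_avoiding_second[of "{1..n}" "{1..m}"] assms by simp
  also note expectation_num_avoiding[OF assms]
  also have "2 * ((real n + 1) * (real n + 2)) / ((real m + 1) * (real m + 2))
      - 3 * ((real n - real m) / (real m + 1)) - 2 =
    (real n - real m) * (2 * real n - real m) / ((real m + 1) * (real m + 2))"
    by (simp add: divide_simps) (simp add: algebra_simps)
  finally show ?thesis .
qed

theorem corollary6:
  fixes m n :: nat
  assumes "1 \<le> m" and "m \<le> n"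
  shows "measure_pmf.expectation (random_perm n) (avoiding_fraction n m) < 1 / (real m + 1)
    \<and> std_dev (random_perm n) (avoiding_fraction n m) < 1 / (real m + 1)"
proof -
  let ?P = "random_perm n"
  let ?E = "measure_pmf.expectation ?P" and ?F = "avoiding_fraction n m"
  let ?X = "\<lambda>p. real (num_avoiding {1..n} {1..m} p)"
  \<comment> \<open>Writing n = k + m with k nonnegative removes the subtractions from both moment
    formulas.\<close>
  define k where "k = real n - real m"
  have k: "k \<ge> 0" "real n = k + real m" using assms by (auto simp: k_def)
  have pos: "real n > 0" "real m > 0" using assms by auto
  have F: "?F p = ?X p / real n" if "p permutes {1..n}" for p
    using num_avoiding_eq[OF that, of "{1..m}"] assms by (simp add: avoiding_fraction_def)
  have "?E ?F = ?E (\<lambda>p. ?X p / real n)"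
    by (intro integral_cong_AE) (auto simp: AE_measure_pmf_iff F)
  then have EF: "?E ?F = k / (real m + 1) / real n"
    using expectation_num_avoiding[OF assms(2)] by (simp add: k_def)
  have "?E (\<lambda>p. (?F p)\<^sup>2) = ?E (\<lambda>p. (?X p)\<^sup>2 / (real n)\<^sup>2)"
    by (intro integral_cong_AE) (auto simp: AE_measure_pmf_iff F power_divide)
  then have EF2: "?E (\<lambda>p. (?F p)\<^sup>2) =
      k * (2 * k + real m) / ((real m + 1) * (real m + 2)) / (real n)\<^sup>2"
    using expectation_num_avoiding_square[OF assms(2)] by (simp add: k(2))
  have "k < real n" using k pos by simp
  then have "k / real n / (real m + 1) < 1 / (real m + 1)"
    using pos by (intro divide_strict_right_mono) auto
  then have "?E ?F < 1 / (real m + 1)"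
    unfolding EF by (simp add: mult.commute)
  moreover have "measure_pmf.variance ?P ?F < (1 / (real m + 1))\<^sup>2"
  proof -
    have "measure_pmf.variance ?P ?F = ?E (\<lambda>p. (?F p)\<^sup>2) - (?E ?F)\<^sup>2"
      by (rule measure_pmf.variance_eq) auto
    \<comment> \<open>The bound equals n^2 over this same denominator, so only numerators remain to
      be compared.\<close>
    also have "\<dots> = (k * (2 * k + real m) * (real m + 1) / (real m + 2) - k\<^sup>2) /
        ((real m + 1)\<^sup>2 * (real n)\<^sup>2)"
      unfolding EF EF2 using pos by (simp add: divide_simps) (simp add: power2_eq_square algebra_simps)
    also have "\<dots> < (real n)\<^sup>2 / ((real m + 1)\<^sup>2 * (real n)\<^sup>2)"
    proof (rule divide_strict_right_mono)
      \<comment> \<open>Bounding (m+1)/(m+2) by 1 leaves k(2k+m) < k^2 + (k+m)^2; the two sides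
        differ by m(k+m), which is positive.\<close>
      have "k * (2 * k + real m) * (real m + 1) \<le> k * (2 * k + real m) * (real m + 2)"
        using k pos by (intro mult_left_mono) auto
      then have "k * (2 * k + real m) * (real m + 1) / (real m + 2) \<le> k * (2 * k + real m)"
        using pos by (simp add: divide_simps)
      also have "k * (2 * k + real m) < k\<^sup>2 + (k + real m)\<^sup>2"
        using k pos by (simp add: power2_eq_square algebra_simps add_nonneg_pos)
      finally show "k * (2 * k + real m) * (real m + 1) / (real m + 2) - k\<^sup>2 < (real n)\<^sup>2"
        by (simp add: k(2))
    qed (use pos in simp)
    also have "\<dots> = (1 / (real m + 1))\<^sup>2"
      using pos by (simp add: power_divide)
    finally show ?thesis .
  qed
  then have "std_dev ?P ?F < 1 / (real m + 1)"
    unfolding std_dev_def by (intro real_less_lsqrt) auto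
  ultimately show ?thesis ..
qed

end
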